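(* Let $A,v$ satisfy: $0\le A(t)\in L^\infty_{\mathrm{loc}}([0,+\infty))$, $A\not\equiv0$ (in the $L^\infty_{\mathrm{loc}}$ sense); $0\le v(t)\in L^\infty_{\mathrm{loc}}([0,+\infty))$, $\frac1{v(t)}\in L^\infty_{\mathrm{loc}}((0,+\infty))$, $\lim_{t\to0^+}v(t)=0$. Suppose that either $1/v\notin L^1(+\infty)$ (in which case let $0<T<t$ be any numbers such that $A\not\equiv0$ on $[0,T]$), or otherwise that there exist $0<T<t$ such that $$\int_T^t\big(\sqrt{A(s)}-\sqrt{\chi(s)}\big)ds>-\frac12\Big(\log\int_0^TA(s)v(s)ds+\log\int_T^{+\infty}\frac{ds}{v(s)}\Big).$$ Then, for every solution $z(t)\in\mathrm{Lip}_{\mathrm{loc}}([0,+\infty))$ of $$\begin{cases}(v(t)z'(t))'+A(t)v(t)z(t)=0&\text{almost everywhere on }(0,+\infty)\\ z'(t)=O(1)\ \text{as }t\downarrow0^+,\quad z(0^+)=z_0>0,\end{cases}$$ there exists $T_0=T_0(z)>0$ such that $z(T_0)=0$. Moreover, the first zero is attained on $(0,\overline R]$, where $\overline R>0$ is the unique real number satisfying $$\int_T^t\sqrt{A(s)}\,ds=-\frac12\log\int_0^TA(s)v(s)ds-\frac12\log\int_t^{\overline R}\frac{ds}{v(s)}.$$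
   Context: $1/v\in L^1(+\infty)$ means that $1/v$ is integrable on $[R,+\infty)$ for some large $R$. When $1/v\in L^1(+\infty)$, the critical function is $\chi(t)=\Big(2v(t)\int_t^{+\infty}\frac{ds}{v(s)}\Big)^{-2}$. $\mathrm{Lip}_{\mathrm{loc}}$ denotes locally Lipschitz functions. A solution of the Cauchy problem is understood in the integrated sense, i.e. $z(t)=z_0-\int_0^t\frac1{v(s)}\Big\{\int_0^sA(x)v(x)z(x)dx\Big\}ds$. *)

theory Defs
  imports "HOL-Analysis.Analysis"
begin

definition Linf_loc :: "real set \<Rightarrow> (real \<Rightarrow> real) \<Rightarrow> bool" where
  "Linf_loc S f \<longleftrightarrow> set_borel_measurable lebesgue S f \<and>
     (\<forall>K. compact K \<and> K \<subseteq> S \<longrightarrow> (\<exists>C. AE x in lebesgue. x \<in> K \<longrightarrow> \<bar>f x\<bar> \<le> C))"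

definition Lip_loc :: "real set \<Rightarrow> (real \<Rightarrow> real) \<Rightarrow> bool" where
  "Lip_loc S f \<longleftrightarrow> (\<forall>x\<in>S. \<exists>u>0. \<exists>L. L-lipschitz_on (cball x u \<inter> S) f)"

definition L1_at_infinity :: "(real \<Rightarrow> real) \<Rightarrow> bool" where
  "L1_at_infinity f \<longleftrightarrow> (\<exists>R>0. set_integrable lebesgue {R..} f)"

(* Meaningful only when 1/v is integrable at infinity. *)
definition critical_fun :: "(real \<Rightarrow> real) \<Rightarrow> real \<Rightarrow> real" where
  "critical_fun v t = 1 / (2 * v t * (LINT s:{t..}|lebesgue. 1 / v s))\<^sup>2"

(* Since 1 / 0 = 0 in HOL, boundedness of 1 / v does not exclude v = 0; that v is nonzero
   almost everywhere, implicit in 1/v being an element of Linf_loc, is a separate conjunct. *)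
definition admissible_weight :: "(real \<Rightarrow> real) \<Rightarrow> bool" where
  "admissible_weight v \<longleftrightarrow>
     Linf_loc {0..} v \<and> (AE s in lebesgue. 0 \<le> s \<longrightarrow> 0 \<le> v s) \<and>
     (AE s in lebesgue. 0 < s \<longrightarrow> v s \<noteq> 0) \<and> Linf_loc {0<..} (\<lambda>s. 1 / v s) \<and>
     (v \<longlongrightarrow> 0) (at_right 0)"

definition admissible_potential :: "(real \<Rightarrow> real) \<Rightarrow> bool" where
  "admissible_potential A \<longleftrightarrow>
     Linf_loc {0..} A \<and> (AE s in lebesgue. 0 \<le> s \<longrightarrow> 0 \<le> A s) \<and>
     \<not> (AE s in lebesgue. 0 \<le> s \<longrightarrow> A s = 0)"

(* Locally Lipschitz solutions of (v z')' + A v z = 0 with z' = O(1) at 0+ and z(0+) = z0, the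
   equation being understood in integrated form.  The integrability conjunct is needed because
   1/v may blow up at 0 and the Bochner integral of a non-integrable function is 0.  As z is
   only differentiable almost everywhere, the bound on z' is an essential one. *)
definition cauchy_solution ::
  "(real \<Rightarrow> real) \<Rightarrow> (real \<Rightarrow> real) \<Rightarrow> real \<Rightarrow> (real \<Rightarrow> real) \<Rightarrow> bool" where
  "cauchy_solution A v z0 z \<longleftrightarrow>
     Lip_loc {0..} z \<and>
     (\<forall>t\<ge>0.
        set_integrable lebesgue {0..t}
          (\<lambda>s. 1 / v s * (LINT x:{0..s}|lebesgue. A x * v x * z x)) \<and>
        z t = z0 - (LINT s:{0..t}|lebesgue.
                      1 / v s * (LINT x:{0..s}|lebesgue. A x * v x * z x))) \<and>
     (\<exists>C. \<exists>\<delta>>0. AE s in lebesgue. 0 < s \<and> s < \<delta> \<longrightarrow>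
        (\<exists>d. (z has_real_derivative d) (at s) \<and> \<bar>d\<bar> \<le> C)) \<and>
     (z \<longlongrightarrow> z0) (at_right 0)"

(* The real R for which int_T^t sqrt A = - 1/2 log int_0^T A v - 1/2 log int_t^R 1/v.
   The last logarithm is defined exactly for R > t (HOL's ln is total). *)
definition zero_bound ::
  "(real \<Rightarrow> real) \<Rightarrow> (real \<Rightarrow> real) \<Rightarrow> real \<Rightarrow> real \<Rightarrow> real \<Rightarrow> bool" where
  "zero_bound A v T t R \<longleftrightarrow> t < R \<and>
     (LINT s:{T..t}|lebesgue. sqrt (A s)) =
       - (1 / 2) * ln (LINT s:{0..T}|lebesgue. A s * v s)
       - (1 / 2) * ln (LINT s:{t..R}|lebesgue. 1 / v s)"

(* Positivity of int_0^T A v excludes the case where its logarithm is minus infinity and the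
   inequality fails; HOL has ln 0 = 0. *)
definition oscillation_condition ::
  "(real \<Rightarrow> real) \<Rightarrow> (real \<Rightarrow> real) \<Rightarrow> real \<Rightarrow> real \<Rightarrow> bool" where
  "oscillation_condition A v T t \<longleftrightarrow>
     0 < (LINT s:{0..T}|lebesgue. A s * v s) \<and>
     (LINT s:{T..t}|lebesgue. sqrt (A s) - sqrt (critical_fun v s)) >
       - (1 / 2) * (ln (LINT s:{0..T}|lebesgue. A s * v s) +
                    ln (LINT s:{T..}|lebesgue. 1 / v s))"

end

theory Submission
  imports Defs
begin

text \<open>
  Let \<open>g s = \<integral>\<^sub>0\<^sup>s A v z\<close>, so that \<open>g = - v z'\<close>, and suppose \<open>z > 0\<close> on \<open>[0, R]\<close>. Then \<open>y = g / z\<close>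
  solves the Riccati equation \<open>y' = A v + y\<^sup>2 / v\<close>. As \<open>z\<close> decreases, \<open>y T \<ge> \<integral>\<^sub>0\<^sup>T A v\<close>; by AM-GM,
  \<open>y' \<ge> 2 y \<surd>A\<close> on \<open>[T, t]\<close>; and \<open>z R > 0\<close> forces \<open>1 / y t > \<integral>\<^sub>t\<^sup>R 1 / v\<close>. Together these contradict the
  equation that defines \<open>R\<close>. That equation is solvable because, when \<open>1 / v\<close> is integrable, \<open>\<surd>\<chi>\<close> is
  minus half the logarithmic derivative of \<open>\<integral>\<^sub>s\<^sup>\<infinity> 1 / v\<close>.

  The differential inequalities are replaced by finite differences with a quadratic error, so that
  no almost-everywhere differentiation is needed.
\<close>

section \<open>Additivity of integrals and finite-difference estimates\<close>

lemma set_integral_combine: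
  fixes f :: "real \<Rightarrow> real"
  assumes "set_integrable lebesgue {a..c} f" "a \<le> b" "b \<le> c"
  shows "(LINT s:{a..c}|lebesgue. f s) = (LINT s:{a..b}|lebesgue. f s) + (LINT s:{b..c}|lebesgue. f s)"
proof -
  have i: "set_integrable lebesgue {a..b} f" "set_integrable lebesgue {b..c} f"
    using assms by (auto intro: set_integrable_subset[OF assms(1)])
  show ?thesis
    using i assms by (simp add: set_lebesgue_integral_eq_integral Henstock_Kurzweil_Integration.integral_combine)
qed
text \<open>Cut \<open>[a, b]\<close> into \<open>Suc n\<close> equal steps of length
  \<open>h\<close>. Each step loses at most \<open>K * h\<^sup>2\<close>, so the total loss is
  \<open>K * (b - a)\<^sup>2 / Suc n\<close>, which tends to 0. This stands in for the rule that a
  function with nonnegative derivative is nondecreasing.\<close>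

lemma quadratic_error_mono:
  fixes \<phi> :: "real \<Rightarrow> real"
  assumes "a \<le> b"
    and step: "\<And>s s'. a \<le> s \<Longrightarrow> s \<le> s' \<Longrightarrow> s' \<le> b \<Longrightarrow> \<phi> s - K * (s' - s)\<^sup>2 \<le> \<phi> s'"
  shows "\<phi> a \<le> \<phi> b"
proof -
  have bound: "\<phi> a - K * (b - a)\<^sup>2 / real (Suc n) \<le> \<phi> b" for n
  proof -
    define h where "h = (b - a) / real (Suc n)"
    have h: "0 \<le> h" "real (Suc n) * h = b - a"
      using \<open>a \<le> b\<close> by (auto simp: h_def)
    have "\<phi> a - real k * (K * h\<^sup>2) \<le> \<phi> (a + real k * h)" if "k \<le> Suc n" for k
      using that
    proof (induction k)
      case 0
      show ?case by simp
    next
      case (Suc k)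
      have "real (Suc k) * h \<le> real (Suc n) * h"
        using Suc.prems h(1) by (intro mult_right_mono) auto
      then have "\<phi> (a + real k * h) - K * (a + real (Suc k) * h - (a + real k * h))\<^sup>2
          \<le> \<phi> (a + real (Suc k) * h)"
        using h by (intro step) (auto simp: algebra_simps)
      moreover have "a + real (Suc k) * h - (a + real k * h) = h"
        by (simp add: algebra_simps)
      ultimately show ?case
        using Suc by (simp add: algebra_simps)
    qed
    from this[of "Suc n"] have "\<phi> a - real (Suc n) * (K * h\<^sup>2) \<le> \<phi> b"
      using h(2) by simp
    moreover have "real (Suc n) * (K * h\<^sup>2) = K * (b - a)\<^sup>2 / real (Suc n)"
      unfolding h_def by (simp add: power2_eq_square field_simps del: of_nat_Suc)
    ultimately show ?thesis by simp
  qed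
  have "(\<lambda>n. \<phi> a - K * (b - a)\<^sup>2 * inverse (real (Suc n))) \<longlonglongrightarrow> \<phi> a - K * (b - a)\<^sup>2 * 0"
    by (intro tendsto_intros LIMSEQ_inverse_real_of_nat)
  from LIMSEQ_le_const2[OF this] show ?thesis
    using bound by (auto simp: divide_inverse)
qed

text \<open>The bound \<open>ln x \<le> x - 1\<close> at \<open>x = 1 / (1 + d)\<close> gives
  \<open>ln (1 + d) \<ge> d / (1 + d)\<close>. The loss against \<open>d\<close> is quadratic, the
  kind of error that \<open>quadratic_error_mono\<close> tolerates.\<close>

lemma ln_one_plus_ge:
  fixes d :: real
  assumes "0 \<le> d"
  shows "d - d\<^sup>2 \<le> ln (1 + d)"
proof -
  have "1 - 1 / (1 + d) \<le> ln (1 + d)"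
    using ln_le_minus_one[of "1 / (1 + d)"] assms by (simp add: ln_div)
  moreover have "d - d\<^sup>2 \<le> 1 - 1 / (1 + d)"
    using assms by (simp add: field_simps power2_eq_square)
  ultimately show ?thesis by linarith
qed

section \<open>Continuity and local essential boundedness\<close>

lemma continuous_on_Lip_loc:
  assumes "Lip_loc S f"
  shows "continuous_on S f"
proof (clarsimp simp: continuous_on_eq_continuous_within)
  fix x assume x: "x \<in> S"
  obtain u L where u: "0 < u" "L-lipschitz_on (cball x u \<inter> S) f"
    using assms x unfolding Lip_loc_def by blast
  have "continuous (at x within cball x u \<inter> S) f"
    using lipschitz_on_continuous_within[OF u(2)] x u(1) by auto
  moreover have "at x within cball x u \<inter> S = at x within S"
    by (rule at_within_nhd[of _ "ball x u"]) (use u(1) in auto)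
  ultimately show "continuous (at x within S) f" by simp
qed

lemma Linf_loc_subset:
  assumes "Linf_loc S f" "S' \<subseteq> S" "S' \<in> sets lebesgue"
  shows "Linf_loc S' f"
  using assms set_borel_measurable_subset[of lebesgue S f S'] unfolding Linf_loc_def by blast

lemma Linf_loc_mult:
  assumes "Linf_loc S f" "Linf_loc S g"
  shows "Linf_loc S (\<lambda>x. f x * g x)"
  unfolding Linf_loc_def
proof (intro conjI allI impI)
  have "(\<lambda>x. (indicator S x *\<^sub>R f x) * (indicator S x *\<^sub>R g x)) \<in> borel_measurable lebesgue"
    using assms unfolding Linf_loc_def set_borel_measurable_def by (intro borel_measurable_times) auto
  also have "(\<lambda>x. (indicator S x *\<^sub>R f x) * (indicator S x *\<^sub>R g x))
      = (\<lambda>x. indicator S x *\<^sub>R (f x * g x))"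
    by (auto simp: indicator_def)
  finally show "set_borel_measurable lebesgue S (\<lambda>x. f x * g x)"
    unfolding set_borel_measurable_def .
next
  fix K assume K: "compact K \<and> K \<subseteq> S"
  obtain C D where C: "AE x in lebesgue. x \<in> K \<longrightarrow> \<bar>f x\<bar> \<le> C"
    and D: "AE x in lebesgue. x \<in> K \<longrightarrow> \<bar>g x\<bar> \<le> D"
    using assms K unfolding Linf_loc_def by blast
  have "AE x in lebesgue. x \<in> K \<longrightarrow> \<bar>f x * g x\<bar> \<le> C * D"
    using C D
  proof eventually_elim
    case (elim x)
    then show ?case
      using mult_mono[of "\<bar>f x\<bar>" C "\<bar>g x\<bar>" D] by (auto simp: abs_mult)
  qed
  then show "\<exists>C. AE x in lebesgue. x \<in> K \<longrightarrow> \<bar>f x * g x\<bar> \<le> C" ..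
qed

lemma Linf_loc_continuous:
  assumes "continuous_on S f" "S \<in> sets borel"
  shows "Linf_loc S f"
  unfolding Linf_loc_def
proof (intro conjI allI impI)
  have "(\<lambda>x. indicator S x *\<^sub>R f x) \<in> borel_measurable lborel"
    using borel_measurable_continuous_on_indicator[OF assms(2,1)] by simp
  then show "set_borel_measurable lebesgue S f"
    unfolding set_borel_measurable_def by (rule measurable_completion)
next
  fix K assume "compact K \<and> K \<subseteq> S"
  then have "bounded (f ` K)"
    using assms(1) by (meson compact_continuous_image compact_imp_bounded continuous_on_subset)
  then obtain C where "\<And>x. x \<in> K \<Longrightarrow> \<bar>f x\<bar> \<le> C"
    by (auto simp: bounded_iff)
  then show "\<exists>C. AE x in lebesgue. x \<in> K \<longrightarrow> \<bar>f x\<bar> \<le> C" by auto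
qed

lemma Linf_loc_abs:
  assumes "Linf_loc S f"
  shows "Linf_loc S (\<lambda>x. \<bar>f x\<bar>)"
proof -
  have "(\<lambda>x. \<bar>indicator S x *\<^sub>R f x\<bar>) \<in> borel_measurable lebesgue"
    using assms unfolding Linf_loc_def set_borel_measurable_def by (intro borel_measurable_abs) auto
  also have "(\<lambda>x. \<bar>indicator S x *\<^sub>R f x\<bar>) = (\<lambda>x. indicator S x *\<^sub>R \<bar>f x\<bar>)"
    by (auto simp: indicator_def)
  finally show ?thesis
    using assms unfolding Linf_loc_def set_borel_measurable_def by simp
qed

lemma Linf_loc_sqrt:
  assumes "Linf_loc S f"
  shows "Linf_loc S (\<lambda>x. sqrt (f x))"
  unfolding Linf_loc_def
proof (intro conjI allI impI)
  have "(\<lambda>x. sqrt (indicator S x *\<^sub>R f x)) \<in> borel_measurable lebesgue"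
    using assms unfolding Linf_loc_def set_borel_measurable_def by auto
  also have "(\<lambda>x. sqrt (indicator S x *\<^sub>R f x)) = (\<lambda>x. indicator S x *\<^sub>R sqrt (f x))"
    by (auto simp: indicator_def)
  finally show "set_borel_measurable lebesgue S (\<lambda>x. sqrt (f x))"
    unfolding set_borel_measurable_def .
next
  fix K assume "compact K \<and> K \<subseteq> S"
  then obtain C where "AE x in lebesgue. x \<in> K \<longrightarrow> \<bar>f x\<bar> \<le> C"
    using assms unfolding Linf_loc_def by blast
  \<comment> \<open>HOL's \<open>sqrt\<close> is odd and monotone on all reals, so the bound passes
    through it whatever the sign of \<open>f x\<close>.\<close>
  then have "AE x in lebesgue. x \<in> K \<longrightarrow> \<bar>sqrt (f x)\<bar> \<le> sqrt C"
    by eventually_elim (auto simp: abs_le_iff simp flip: real_sqrt_minus)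
  then show "\<exists>C. AE x in lebesgue. x \<in> K \<longrightarrow> \<bar>sqrt (f x)\<bar> \<le> C" ..
qed

lemma Linf_loc_set_integrable:
  assumes "Linf_loc S f" "compact K" "K \<subseteq> S"
  shows "set_integrable lebesgue K f"
proof -
  obtain C where C: "AE x in lebesgue. x \<in> K \<longrightarrow> \<bar>f x\<bar> \<le> C"
    using assms unfolding Linf_loc_def by blast
  have "(\<lambda>x. indicator K x *\<^sub>R f x) \<in> borel_measurable lebesgue"
    using assms set_borel_measurable_subset[of lebesgue S f K] lmeasurable_compact[OF assms(2)]
    unfolding Linf_loc_def set_borel_measurable_def by auto
  moreover have "K \<in> lmeasurable" using assms(2) by (rule lmeasurable_compact)
  ultimately show ?thesis
    unfolding set_integrable_def
    by (intro integrableI_bounded_set[where A=K and B=C])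
      (use C in \<open>auto simp: fmeasurable_def indicator_def\<close>)
qed

section \<open>Signs of integrals and integrability of the reciprocal weight\<close>

text \<open>A non-integrable function has integral 0 by convention, so the claim covers that case as
  well.\<close>

lemma set_integral_nonneg_AE:
  fixes f :: "'a \<Rightarrow> real"
  assumes "AE x in M. x \<in> S \<longrightarrow> 0 \<le> f x"
  shows "0 \<le> (LINT x:S|M. f x)"
  unfolding set_lebesgue_integral_def
  by (rule integral_nonneg_AE) (use assms in eventually_elim, auto simp: indicator_def)

lemma set_integral_pos_AE:
  fixes f :: "'a \<Rightarrow> real"
  assumes "set_integrable M S f" "AE x in M. x \<in> S \<longrightarrow> 0 \<le> f x"
    and "\<not> (AE x in M. x \<in> S \<longrightarrow> f x = 0)"
  shows "0 < (LINT x:S|M. f x)"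
proof (rule ccontr)
  assume "\<not> ?thesis"
  then have "(LINT x:S|M. f x) = 0"
    using set_integral_nonneg_AE[OF assms(2)] by simp
  moreover have "AE x in M. 0 \<le> indicator S x *\<^sub>R f x"
    using assms(2) by eventually_elim (auto simp: indicator_def)
  ultimately have "AE x in M. indicator S x *\<^sub>R f x = 0"
    using assms(1) integral_nonneg_eq_0_iff_AE
    unfolding set_integrable_def set_lebesgue_integral_def by blast
  then have "AE x in M. x \<in> S \<longrightarrow> f x = 0"
    by eventually_elim (auto simp: indicator_def)
  then show False using assms(3) by blast
qed

lemma admissible_weight_pos:
  assumes "admissible_weight v"
  shows "AE s in lebesgue. 0 < s \<longrightarrow> 0 < v s"
proof -
  have "AE s in lebesgue. 0 \<le> s \<longrightarrow> 0 \<le> v s" "AE s in lebesgue. 0 < s \<longrightarrow> v s \<noteq> 0"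
    using assms by (auto simp: admissible_weight_def)
  then show ?thesis by eventually_elim auto
qed

text \<open>Local boundedness of \<open>1 / v\<close> is available only away from 0, hence the
  positive left endpoint.\<close>

lemma admissible_weight_integrable:
  assumes "admissible_weight v" "0 < a"
  shows "set_integrable lebesgue {a..b} (\<lambda>s. 1 / v s)"
  using assms by (intro Linf_loc_set_integrable[of "{0<..}"]) (auto simp: admissible_weight_def)

lemma admissible_weight_integral_pos:
  assumes v: "admissible_weight v" and ab: "0 < a" "a < b"
  shows "0 < (LINT s:{a..b}|lebesgue. 1 / v s)"
proof (rule set_integral_pos_AE)
  show "set_integrable lebesgue {a..b} (\<lambda>s. 1 / v s)"
    using v ab(1) by (rule admissible_weight_integrable)
  show "AE x in lebesgue. x \<in> {a..b} \<longrightarrow> 0 \<le> 1 / v x"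
    using admissible_weight_pos[OF v] by eventually_elim (use ab in auto)
  show "\<not> (AE x in lebesgue. x \<in> {a..b} \<longrightarrow> 1 / v x = 0)"
  proof
    \<comment> \<open>Almost everywhere \<open>v\<close> is positive, so \<open>1 / v\<close> can
      vanish almost everywhere on the interval only if the interval is a null set.\<close>
    assume "AE x in lebesgue. x \<in> {a..b} \<longrightarrow> 1 / v x = 0"
    with admissible_weight_pos[OF v] have "AE x in lebesgue. x \<notin> {a..b}"
      by eventually_elim (use ab in auto)
    then have "emeasure lebesgue {a..b} = 0"
      by (subst (asm) AE_iff_measurable[of "{a..b}"]) auto
    then show False using ab by simp
  qed
qed

section \<open>Riccati comparison for solutions of the Cauchy problem\<close>

lemma continuous_on_cauchy_solution:
  assumes "cauchy_solution A v z0 z"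
  shows "continuous_on {0..} z"
  using assms by (auto simp: cauchy_solution_def intro: continuous_on_Lip_loc)

lemma cauchy_solution_init:
  assumes "cauchy_solution A v z0 z"
  shows "z 0 = z0"
proof -
  have "(z \<longlongrightarrow> z 0) (at_right 0)"
    using continuous_on_cauchy_solution[OF assms]
    by (auto simp: continuous_on_def intro: tendsto_within_subset)
  moreover have "(z \<longlongrightarrow> z0) (at_right 0)" using assms by (simp add: cauchy_solution_def)
  ultimately show ?thesis by (rule tendsto_unique[rotated]) simp
qed

text \<open>The conclusion is the equation in \<open>zero_bound\<close> with \<open><\<close> in
  place of \<open>=\<close>, so a solution without zeros on \<open>[0, R]\<close> is incompatible
  with that equation. The strictness comes from \<open>z R > 0\<close>; the other links of the chain
  are weak inequalities.\<close>

lemma cauchy_solution_positive_bound: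
  assumes A: "admissible_potential A" and v: "admissible_weight v"
    and order: "0 < T" "T < t" "t < R"
    and I: "0 < (LINT s:{0..T}|lebesgue. A s * v s)"
    and z: "cauchy_solution A v z0 z" "0 < z0" "\<And>s. 0 \<le> s \<Longrightarrow> s \<le> R \<Longrightarrow> z s \<noteq> 0"
  shows "(LINT s:{T..t}|lebesgue. sqrt (A s)) <
       - (1 / 2) * ln (LINT s:{0..T}|lebesgue. A s * v s)
       - (1 / 2) * ln (LINT s:{t..R}|lebesgue. 1 / v s)"
proof -
  define g where "g s = (LINT x:{0..s}|lebesgue. A x * v x * z x)" for s
  define y where "y s = g s / z s" for s
  have A_nonneg: "AE s in lebesgue. 0 \<le> s \<longrightarrow> 0 \<le> A s" and A_Linf: "Linf_loc {0..} A"
    using A by (auto simp: admissible_potential_def)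
  have v_nonneg: "AE s in lebesgue. 0 \<le> s \<longrightarrow> 0 \<le> v s" and v_Linf: "Linf_loc {0..} v"
    using v by (auto simp: admissible_weight_def)
  note v_pos = admissible_weight_pos[OF v]
  have z_cont: "continuous_on {0..} z"
    using z(1) by (rule continuous_on_cauchy_solution)
  \<comment> \<open>Since \<open>1 / v\<close> may blow up at 0, integrability of the flux term down
    to 0 is read off from the notion of solution. Integrability of \<open>1 / v\<close> alone is
    claimed only on intervals with positive left endpoint, which is why later estimates assume
    \<open>0 < s\<close>.\<close>
  have flux_int: "set_integrable lebesgue {0..s} (\<lambda>x. 1 / v x * g x)"
    and z_eq: "z s = z0 - (LINT x:{0..s}|lebesgue. 1 / v x * g x)" if "0 \<le> s" for s
    using z(1) that by (auto simp: cauchy_solution_def g_def)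
  have Av_Linf: "Linf_loc {0..} (\<lambda>x. A x * v x)"
    by (intro Linf_loc_mult A_Linf v_Linf)
  have Avz_Linf: "Linf_loc {0..} (\<lambda>x. A x * v x * z x)"
    by (intro Linf_loc_mult[OF Av_Linf] Linf_loc_continuous z_cont) auto
  have Av_int: "set_integrable lebesgue {a..b} (\<lambda>x. A x * v x)" if "0 \<le> a" for a b
    using that by (intro Linf_loc_set_integrable[OF Av_Linf]) auto
  have Avz_int: "set_integrable lebesgue {a..b} (\<lambda>x. A x * v x * z x)" if "0 \<le> a" for a b
    using that by (intro Linf_loc_set_integrable[OF Avz_Linf]) auto
  have sqrtA_int: "set_integrable lebesgue {a..b} (\<lambda>x. sqrt (A x))" if "0 \<le> a" for a b
    using that by (intro Linf_loc_set_integrable[OF Linf_loc_sqrt[OF A_Linf]]) auto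
  have w_int: "set_integrable lebesgue {a..b} (\<lambda>x. 1 / v x)" if "0 < a" for a b
    using admissible_weight_integrable[OF v that] .
  have z_init: "z 0 = z0"
    using z(1) by (rule cauchy_solution_init)
  have z_pos: "0 < z s" if "0 \<le> s" "s \<le> R" for s
  proof (rule ccontr)
    assume "\<not> 0 < z s"
    then have "\<exists>x\<ge>0. x \<le> s \<and> z x = 0"
      using that z(2) z_init by (intro IVT2' continuous_on_subset[OF z_cont]) auto
    then show False using z(3) that by force
  qed
  have Av_nonneg: "AE x in lebesgue. 0 \<le> x \<longrightarrow> 0 \<le> A x * v x"
    using A_nonneg v_nonneg by eventually_elim auto
  have Avz_nonneg: "AE x in lebesgue. 0 \<le> x \<and> x \<le> R \<longrightarrow> 0 \<le> A x * v x * z x"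
    using Av_nonneg by eventually_elim (auto intro!: mult_nonneg_nonneg less_imp_le[OF z_pos])
  have g_nonneg: "0 \<le> g s" if "s \<le> R" for s
    unfolding g_def by (rule set_integral_nonneg_AE, use Avz_nonneg in eventually_elim) (use that in auto)
  have g_diff: "g s' = g s + (LINT x:{s..s'}|lebesgue. A x * v x * z x)" if "0 \<le> s" "s \<le> s'" for s s'
    unfolding g_def using that by (intro set_integral_combine Avz_int) auto
  have g_mono: "g s \<le> g s'" if "0 \<le> s" "s \<le> s'" "s' \<le> R" for s s'
  proof -
    have "0 \<le> (LINT x:{s..s'}|lebesgue. A x * v x * z x)"
      by (rule set_integral_nonneg_AE, use Avz_nonneg in eventually_elim) (use that in auto)
    then show ?thesis using g_diff[of s s'] that by simp
  qed
  have flux_int': "set_integrable lebesgue {s..s'} (\<lambda>x. 1 / v x * g x)" if "0 \<le> s" "s \<le> s'" for s s'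
    using that by (intro set_integrable_subset[OF flux_int[of s']]) auto
  have z_diff: "z s' = z s - (LINT x:{s..s'}|lebesgue. 1 / v x * g x)" if "0 \<le> s" "s \<le> s'" for s s'
    using that set_integral_combine[OF flux_int[of s'], of s] z_eq[of s] z_eq[of s'] by simp
  have z_antimono: "z s' \<le> z s" if "0 \<le> s" "s \<le> s'" "s' \<le> R" for s s'
  proof -
    have "0 \<le> (LINT x:{s..s'}|lebesgue. 1 / v x * g x)"
      by (rule set_integral_nonneg_AE, use v_nonneg in eventually_elim)
        (use that in \<open>auto intro!: divide_nonneg_nonneg g_nonneg\<close>)
    then show ?thesis using z_diff[of s s'] that by simp
  qed
  \<comment> \<open>As \<open>g\<close> is nondecreasing, it may be frozen at its value at the left
    endpoint.\<close>
  have z_step: "z s' \<le> z s - g s * (LINT x:{s..s'}|lebesgue. 1 / v x)"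
    if "0 < s" "s \<le> s'" "s' \<le> R" for s s'
  proof -
    have "(LINT x:{s..s'}|lebesgue. g s * (1 / v x)) \<le> (LINT x:{s..s'}|lebesgue. 1 / v x * g x)"
    proof (rule set_integral_mono_AE)
      show "AE x\<in>{s..s'} in lebesgue. g s * (1 / v x) \<le> 1 / v x * g x"
        using v_nonneg by eventually_elim
          (use that in \<open>auto intro!: divide_right_mono g_mono\<close>)
      show "set_integrable lebesgue {s..s'} (\<lambda>x. g s * (1 / v x))"
        using that by (intro set_integrable_mult_right w_int)
      show "set_integrable lebesgue {s..s'} (\<lambda>x. 1 / v x * g x)"
        using that by (intro flux_int') auto
    qed
    then have "g s * (LINT x:{s..s'}|lebesgue. 1 / v x) \<le> (LINT x:{s..s'}|lebesgue. 1 / v x * g x)"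
      by (simp only: set_integral_mult_right)
    then show ?thesis using z_diff[of s s'] that by linarith
  qed
  \<comment> \<open>As \<open>z\<close> is nonincreasing, it may be frozen at its value at the right
    endpoint.\<close>
  have g_step: "g s + z s' * (LINT x:{s..s'}|lebesgue. A x * v x) \<le> g s'"
    if "0 \<le> s" "s \<le> s'" "s' \<le> R" for s s'
  proof -
    have "(LINT x:{s..s'}|lebesgue. z s' * (A x * v x)) \<le> (LINT x:{s..s'}|lebesgue. A x * v x * z x)"
    proof (rule set_integral_mono_AE)
      show "AE x\<in>{s..s'} in lebesgue. z s' * (A x * v x) \<le> A x * v x * z x"
        using Av_nonneg
      proof eventually_elim
        case (elim x)
        then show ?case
          using that z_antimono[of x s'] mult_left_mono[of "z s'" "z x" "A x * v x"]
          by (auto simp: mult.commute)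
      qed
    qed (use that in \<open>auto intro!: Avz_int set_integrable_mult_right Av_int\<close>)
    then show ?thesis using g_diff[of s s'] that by simp
  qed
  have sqrtA_integral_nonneg: "0 \<le> (LINT x:{s..s'}|lebesgue. sqrt (A x))" if "0 \<le> s" for s s'
    by (rule set_integral_nonneg_AE, use A_nonneg in eventually_elim) (use that in auto)
  have w_integral_nonneg: "0 \<le> (LINT x:{s..s'}|lebesgue. 1 / v x)" if "0 \<le> s" for s s'
    by (rule set_integral_nonneg_AE, use v_nonneg in eventually_elim) (use that in auto)
  \<comment> \<open>The Riccati equation as a one-sided difference inequality. No error term
    appears, because the monotonicity of \<open>g\<close> and \<open>z\<close> makes every
    replacement of a value go in the favourable direction.\<close>
  have riccati: "y s + (LINT x:{s..s'}|lebesgue. A x * v x) + (y s)\<^sup>2 * (LINT x:{s..s'}|lebesgue. 1 / v x) \<le> y s'"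
    if "0 < s" "s \<le> s'" "s' \<le> R" for s s'
  proof -
    define a where "a = (LINT x:{s..s'}|lebesgue. A x * v x)"
    define b where "b = (LINT x:{s..s'}|lebesgue. 1 / v x)"
    have "0 \<le> g s" "0 < z s" "0 < z s'" "z s' \<le> z s" "0 \<le> b" "z s' \<le> z s - g s * b"
      "g s + z s' * a \<le> g s'"
      using that g_nonneg[of s] z_pos z_antimono[of s s'] z_step[of s s'] g_step[of s s'] w_integral_nonneg[of s s']
      unfolding a_def b_def by auto
    have "(y s)\<^sup>2 * b = (g s / z s) * ((g s * b) / z s)"
      by (simp add: y_def power2_eq_square)
    \<comment> \<open>The numerator grows by \<open>z_step\<close> and the denominator shrinks since
      \<open>z\<close> decreases. The new product is exactly \<open>g s / z s' - g s / z s\<close>,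
      so \<open>y s\<close> cancels in the sum below.\<close>
    also have "\<dots> \<le> (g s / z s) * ((z s - z s') / z s')"
      using \<open>0 \<le> g s\<close> \<open>0 < z s\<close> \<open>0 < z s'\<close> \<open>z s' \<le> z s\<close> \<open>0 \<le> b\<close> \<open>z s' \<le> z s - g s * b\<close>
      by (intro mult_left_mono frac_le) auto
    also have "\<dots> = g s / z s' - y s"
      using \<open>0 < z s\<close> \<open>0 < z s'\<close> by (simp add: y_def field_simps)
    finally have "y s + (y s)\<^sup>2 * b + a \<le> (g s + z s' * a) / z s'"
      using \<open>0 < z s'\<close> by (simp add: add_divide_distrib)
    also have "\<dots> \<le> y s'"
      unfolding y_def using \<open>0 < z s'\<close> \<open>g s + z s' * a \<le> g s'\<close> by (intro divide_right_mono) auto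
    finally show ?thesis by (simp add: a_def b_def)
  qed
  have y_growth: "y s * (1 + 2 * (LINT x:{s..s'}|lebesgue. sqrt (A x))) \<le> y s'"
    if "0 < s" "s \<le> s'" "s' \<le> R" for s s'
  proof -
    have "(LINT x:{s..s'}|lebesgue. (2 * y s) * sqrt (A x))
        \<le> (LINT x:{s..s'}|lebesgue. A x * v x + (y s)\<^sup>2 * (1 / v x))"
    proof (rule set_integral_mono_AE)
      show "AE x\<in>{s..s'} in lebesgue. (2 * y s) * sqrt (A x) \<le> A x * v x + (y s)\<^sup>2 * (1 / v x)"
        using A_nonneg v_pos
      proof eventually_elim
        case x: (elim x)
        show ?case
        proof
          assume "x \<in> {s..s'}"
          then have pos: "0 \<le> A x" "0 < v x" using x that by auto
          \<comment> \<open>AM-GM for \<open>A v\<close> and \<open>y\<^sup>2 / v\<close>, whose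
            product is \<open>A y\<^sup>2\<close>: the square is expanded and divided by
            \<open>v x\<close>.\<close>
          have "0 \<le> (v x * sqrt (A x) - y s)\<^sup>2 / v x" using pos by simp
          also have "\<dots> = (v x * v x * (sqrt (A x))\<^sup>2 - 2 * y s * sqrt (A x) * v x + (y s)\<^sup>2) / v x"
            by (simp add: power2_eq_square algebra_simps)
          also have "\<dots> = A x * v x - (2 * y s) * sqrt (A x) + (y s)\<^sup>2 * (1 / v x)"
            using pos by (simp add: field_simps)
          finally show "(2 * y s) * sqrt (A x) \<le> A x * v x + (y s)\<^sup>2 * (1 / v x)" by simp
        qed
      qed
      show "set_integrable lebesgue {s..s'} (\<lambda>x. (2 * y s) * sqrt (A x))"
        using that by (intro set_integrable_mult_right sqrtA_int) auto
      show "set_integrable lebesgue {s..s'} (\<lambda>x. A x * v x + (y s)\<^sup>2 * (1 / v x))"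
        using that by (intro set_integral_add set_integrable_mult_right w_int Av_int) auto
    qed
    also have "\<dots> = (LINT x:{s..s'}|lebesgue. A x * v x) + (LINT x:{s..s'}|lebesgue. (y s)\<^sup>2 * (1 / v x))"
      using that by (intro set_integral_add set_integrable_mult_right w_int Av_int) auto
    finally have "2 * y s * (LINT x:{s..s'}|lebesgue. sqrt (A x))
      \<le> (LINT x:{s..s'}|lebesgue. A x * v x) + (y s)\<^sup>2 * (LINT x:{s..s'}|lebesgue. 1 / v x)"
      by (simp only: set_integral_mult_right)
    then show ?thesis using riccati[of s s'] that by (simp add: algebra_simps)
  qed
  have y_T: "(LINT s:{0..T}|lebesgue. A s * v s) \<le> y T"
  proof -
    have "z T * (LINT s:{0..T}|lebesgue. A s * v s) \<le> g T"
      using g_step[of 0 T] g_nonneg[of 0] order by simp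
    then show ?thesis
      using z_pos[of T] order by (simp add: y_def field_simps)
  qed
  have y_pos: "0 < y s" if "T \<le> s" "s \<le> R" for s
  proof -
    have "y T \<le> y T * (1 + 2 * (LINT x:{T..s}|lebesgue. sqrt (A x)))"
      using I y_T order sqrtA_integral_nonneg[of T s] by simp
    then show ?thesis
      using y_growth[of T s] that order I y_T by linarith
  qed
  obtain C where C: "AE x in lebesgue. x \<in> {T..t} \<longrightarrow> \<bar>sqrt (A x)\<bar> \<le> C"
    using Linf_loc_sqrt[OF A_Linf] order unfolding Linf_loc_def
    by (metis atLeastAtMost_iff atLeast_iff compact_Icc less_imp_le order_trans subsetI)
  \<comment> \<open>The inequality \<open>y' \<ge> 2 y sqrt A\<close> says that \<open>ln y\<close>
    grows at least as fast as \<open>2 * sqrt A\<close> integrates, that is, that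
    \<open>\<phi>\<close> is nondecreasing on \<open>[T, t]\<close>.\<close>
  define \<phi> where "\<phi> s = ln (y s) - 2 * (LINT x:{T..s}|lebesgue. sqrt (A x))" for s
  have "\<phi> T \<le> \<phi> t"
  \<comment> \<open>With \<open>q\<close> the integral of \<open>sqrt A\<close> over the step,
    \<open>y_growth\<close> multiplies \<open>y\<close> by at least \<open>1 + 2 * q\<close>, and
    passing to \<open>ln\<close> costs at most \<open>(2 * q)\<^sup>2\<close>. Since
    \<open>q \<le> C * (s' - s)\<close>, this is at most
    \<open>4 * C\<^sup>2 * (s' - s)\<^sup>2\<close>.\<close>
  proof (rule quadratic_error_mono[where \<phi> = \<phi> and K = "4 * C\<^sup>2"])
    fix s s' assume s: "T \<le> s" "s \<le> s'" "s' \<le> t"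
    define q where "q = (LINT x:{s..s'}|lebesgue. sqrt (A x))"
    have q: "0 \<le> q" unfolding q_def using s order by (intro sqrtA_integral_nonneg) auto
    have "q \<le> (LINT x:{s..s'}|lebesgue. C)"
      unfolding q_def
    proof (rule set_integral_mono_AE)
      show "AE x\<in>{s..s'} in lebesgue. sqrt (A x) \<le> C"
        using C by eventually_elim (use s in auto)
    qed (use s order in \<open>auto intro!: sqrtA_int\<close>)
    also have "\<dots> = C * (s' - s)"
      using s by (simp add: set_integral_const)
    finally have "q\<^sup>2 \<le> (C * (s' - s))\<^sup>2" using q by (intro power_mono)
    moreover have "2 * q - (2 * q)\<^sup>2 \<le> ln (1 + 2 * q)"
      using q by (intro ln_one_plus_ge) simp
    moreover have "ln (y s) + ln (1 + 2 * q) \<le> ln (y s')"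
    proof -
      have "0 < y s" "0 < y s'" using y_pos s order by auto
      then have "ln (y s) + ln (1 + 2 * q) = ln (y s * (1 + 2 * q))" using q by (simp add: ln_mult)
      also have "\<dots> \<le> ln (y s')"
        using y_growth[of s s'] s order \<open>0 < y s\<close> \<open>0 < y s'\<close> q unfolding q_def by simp
      finally show ?thesis .
    qed
    moreover have "(LINT x:{T..s'}|lebesgue. sqrt (A x)) = (LINT x:{T..s}|lebesgue. sqrt (A x)) + q"
      unfolding q_def using s order by (intro set_integral_combine sqrtA_int) auto
    ultimately show "\<phi> s - 4 * C\<^sup>2 * (s' - s)\<^sup>2 \<le> \<phi> s'"
      unfolding \<phi>_def by (simp add: power_mult_distrib)
  qed (use order in simp)
  moreover have "(LINT x:{T..T}|lebesgue. sqrt (A x)) = 0"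
    using sqrtA_int[of T T] order by (simp add: set_lebesgue_integral_eq_integral)
  moreover have "ln (LINT s:{0..T}|lebesgue. A s * v s) \<le> ln (y T)"
    using y_T I by simp
  moreover have "ln (LINT s:{t..R}|lebesgue. 1 / v s) < - ln (y t)"
  proof -
    \<comment> \<open>A single step of \<open>z_step\<close> from \<open>t\<close> to
      \<open>R\<close>: freezing \<open>g\<close> at \<open>t\<close> still leaves
      \<open>z R > 0\<close> below the right-hand side, and division by \<open>z t\<close> turns
      this into a bound by \<open>1 / y t\<close>.\<close>
    have "0 < z t - g t * (LINT s:{t..R}|lebesgue. 1 / v s)"
      using z_step[of t R] z_pos[of R] order by simp
    then have "(LINT s:{t..R}|lebesgue. 1 / v s) * y t < 1"
      using z_pos[of t] order by (simp add: y_def field_simps)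
    then have "(LINT s:{t..R}|lebesgue. 1 / v s) < inverse (y t)"
      using y_pos[of t] order by (simp add: field_simps)
    then show ?thesis
      using admissible_weight_integral_pos[OF v, of t R] y_pos[of t] order
      by (simp flip: ln_inverse)
  qed
  ultimately show ?thesis
    unfolding \<phi>_def by simp
qed

section \<open>The equation for the zero bound, and weights not integrable at infinity\<close>

text \<open>Both integrals under the logarithms are positive, so the equation can be exponentiated.
  Finding the bound then means finding where the increasing function of \<open>R\<close> on the left
  reaches a fixed positive level.\<close>

lemma zero_bound_iff:
  assumes v: "admissible_weight v" and "0 < t"
    and I: "0 < (LINT s:{0..T}|lebesgue. A s * v s)"
  shows "zero_bound A v T t R \<longleftrightarrow> t < R \<and>
     (LINT s:{t..R}|lebesgue. 1 / v s) =
       exp (- 2 * (LINT s:{T..t}|lebesgue. sqrt (A s))) / (LINT s:{0..T}|lebesgue. A s * v s)"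
proof (cases "t < R")
  case True
  have "(x = - (1 / 2) * ln i - (1 / 2) * ln b) \<longleftrightarrow> b = exp (- 2 * x) / i"
    if "0 < i" "0 < b" for x i b :: real
  proof -
    have "b = exp (- 2 * x) / i \<longleftrightarrow> ln b = ln (exp (- 2 * x) / i)"
      using that by (subst ln_inj_iff) auto
    also have "\<dots> \<longleftrightarrow> ln b = - 2 * x - ln i"
      using that by (simp add: ln_div)
    also have "\<dots> \<longleftrightarrow> x = - (1 / 2) * ln i - (1 / 2) * ln b"
      by argo
    finally show ?thesis by (rule sym)
  qed
  then show ?thesis
    using I admissible_weight_integral_pos[OF v \<open>0 < t\<close> True] True
    unfolding zero_bound_def by simp
qed (simp add: zero_bound_def)

text \<open>If the integrals stayed below \<open>c\<close>, monotone convergence along the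
  truncations to \<open>[t, t + n]\<close> would make \<open>1 / v\<close> integrable on
  \<open>[t, \<infinity>)\<close>.\<close>

lemma weight_integral_unbounded:
  assumes v: "admissible_weight v" and t: "0 < t"
    and "\<not> L1_at_infinity (\<lambda>s. 1 / v s)"
  shows "\<exists>R>t. c < (LINT s:{t..R}|lebesgue. 1 / v s)"
proof (rule ccontr)
  assume "\<not> ?thesis"
  then have bound: "(LINT s:{t..R}|lebesgue. 1 / v s) \<le> c" if "t < R" for R
    using that by force
  define F where "F n = (\<lambda>s. indicator {t..t + real n} s *\<^sub>R (1 / v s))" for n
  have F_int: "integrable lebesgue (F n)" for n
    using admissible_weight_integrable[OF v t] unfolding F_def set_integrable_def by simp
  have F_mono: "AE s in lebesgue. incseq (\<lambda>n. F n s)"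
    using admissible_weight_pos[OF v]
    by eventually_elim (use t in \<open>auto simp: F_def incseq_def indicator_def\<close>)
  have "integrable lebesgue (\<lambda>s. indicator {t..} s *\<^sub>R (1 / v s))"
  proof (rule integrable_monotone_convergence)
    show "integrable lebesgue (F n)" for n by (rule F_int)
    show "AE s in lebesgue. incseq (\<lambda>n. F n s)" by (rule F_mono)
    show "AE s in lebesgue. (\<lambda>n. F n s) \<longlonglongrightarrow> indicator {t..} s *\<^sub>R (1 / v s)"
    proof (rule AE_I2)
      fix s
      obtain N where N: "s - t \<le> real N" using real_arch_simple by blast
      have "F n s = indicator {t..} s *\<^sub>R (1 / v s)" if "N \<le> n" for n
        using N that by (auto simp: F_def indicator_def)
      then show "(\<lambda>n. F n s) \<longlonglongrightarrow> indicator {t..} s *\<^sub>R (1 / v s)"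
        by (intro tendsto_eventually eventually_sequentiallyI[of N])
    qed
    have "incseq (\<lambda>n. integral\<^sup>L lebesgue (F n))"
      unfolding incseq_def
      by (intro allI impI integral_mono_AE F_int, use F_mono in eventually_elim) (auto simp: incseq_def)
    \<comment> \<open>\<open>bound\<close> speaks of \<open>R > t\<close> only, so
      \<open>n = 0\<close>, where the interval is a point, is treated apart; the \<open>max\<close>
      covers a negative \<open>c\<close>.\<close>
    moreover have "integral\<^sup>L lebesgue (F n) \<le> max c 0" for n
    proof (cases n)
      case 0
      have "integral\<^sup>L lebesgue (F 0) = integral {t..t} (\<lambda>s. 1 / v s)"
        using set_lebesgue_integral_eq_integral(2)[OF admissible_weight_integrable[OF v t, of t]]
        by (simp add: F_def set_lebesgue_integral_def)
      then show ?thesis using 0 by simp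
    next
      case (Suc m)
      then show ?thesis using bound[of "t + real n"] by (simp add: F_def set_lebesgue_integral_def)
    qed
    ultimately show "(\<lambda>n. integral\<^sup>L lebesgue (F n)) \<longlonglongrightarrow> (SUP n. integral\<^sup>L lebesgue (F n))"
      by (intro LIMSEQ_incseq_SUP bdd_aboveI2)
    have "set_borel_measurable lebesgue {0<..} (\<lambda>s. 1 / v s)"
      using v by (auto simp: admissible_weight_def Linf_loc_def)
    then have "set_borel_measurable lebesgue {t..} (\<lambda>s. 1 / v s)"
      by (rule set_borel_measurable_subset) (use t in auto)
    then show "(\<lambda>s. indicator {t..} s *\<^sub>R (1 / v s)) \<in> borel_measurable lebesgue"
      unfolding set_borel_measurable_def .
  qed
  then have "L1_at_infinity (\<lambda>s. 1 / v s)"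
    using t unfolding L1_at_infinity_def set_integrable_def by blast
  then show False using assms(3) by simp
qed

section \<open>Tail integrals of the weight and the critical function\<close>

lemma weight_tail_integrable:
  assumes v: "admissible_weight v" and t: "0 < t" and "L1_at_infinity (\<lambda>s. 1 / v s)"
  shows "set_integrable lebesgue {t..} (\<lambda>s. 1 / v s)"
proof -
  obtain R where R: "set_integrable lebesgue {R..} (\<lambda>s. 1 / v s)"
    using assms(3) by (auto simp: L1_at_infinity_def)
  have "set_integrable lebesgue ({t..R} \<union> {R..}) (\<lambda>s. 1 / v s)"
    by (intro set_integrable_Un R admissible_weight_integrable v t) auto
  then show ?thesis by (rule set_integrable_subset) auto
qed

lemma weight_tail_split:
  assumes v: "admissible_weight v" and s: "0 < s" "s \<le> s'" and L: "L1_at_infinity (\<lambda>s. 1 / v s)"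
  shows "(LINT x:{s..}|lebesgue. 1 / v x)
    = (LINT x:{s..s'}|lebesgue. 1 / v x) + (LINT x:{s'..}|lebesgue. 1 / v x)"
proof -
  \<comment> \<open>The two intervals overlap in the single point \<open>s'\<close>, a null
    set.\<close>
  have "AE x in lebesgue. \<not> (x \<in> {s..s'} \<and> x \<in> {s'..})"
    by (rule eventually_mono[OF AE_completion[OF AE_lborel_singleton[of s']]]) auto
  then have "(LINT x:{s..s'} \<union> {s'..}|lebesgue. 1 / v x)
    = (LINT x:{s..s'}|lebesgue. 1 / v x) + (LINT x:{s'..}|lebesgue. 1 / v x)"
    using s by (intro set_integral_Un_AE admissible_weight_integrable v weight_tail_integrable L) auto
  moreover have "{s..s'} \<union> {s'..} = {s..}" using s by auto
  ultimately show ?thesis by simp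
qed

lemma weight_tail_pos:
  assumes v: "admissible_weight v" and s: "0 < s" and L: "L1_at_infinity (\<lambda>s. 1 / v s)"
  shows "0 < (LINT x:{s..}|lebesgue. 1 / v x)"
proof -
  have "0 \<le> (LINT x:{s + 1..}|lebesgue. 1 / v x)"
    by (rule set_integral_nonneg_AE, use admissible_weight_pos[OF v] in eventually_elim) (use s in auto)
  then show ?thesis
    using weight_tail_split[OF v s, of "s + 1"] admissible_weight_integral_pos[OF v s, of "s + 1"] L
    by simp
qed

text \<open>The product separates the locally bounded \<open>1 / v\<close> from a factor that is
  continuous once the tail is known to be positive. The absolute value keeps the identity valid at
  every \<open>s\<close>, including the null set where \<open>v\<close> may have the wrong
  sign.\<close>

lemma sqrt_critical_fun:
  "sqrt (critical_fun v s) = \<bar>1 / v s * (1 / (2 * (LINT x:{s..}|lebesgue. 1 / v x)))\<bar>"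
proof -
  have "critical_fun v s = (1 / v s * (1 / (2 * (LINT x:{s..}|lebesgue. 1 / v x))))\<^sup>2"
    by (simp add: critical_fun_def power_divide power_mult_distrib)
  then show ?thesis by (simp only: real_sqrt_abs)
qed

lemma sqrt_critical_fun_integrable:
  assumes v: "admissible_weight v" and T: "0 < T" and L: "L1_at_infinity (\<lambda>s. 1 / v s)"
  shows "set_integrable lebesgue {T..t} (\<lambda>s. sqrt (critical_fun v s))"
proof -
  define H where "H s = (LINT x:{s..}|lebesgue. 1 / v x)" for s
  have H_pos: "0 < H s" if "T \<le> s" for s
    unfolding H_def using that T by (intro weight_tail_pos v L) auto
  \<comment> \<open>On \<open>[T, t]\<close> the tail is a constant plus an indefinite integral over
    a compact interval, which yields its continuity.\<close>
  have H_eq: "H s = H t + integral {s..t} (\<lambda>x. 1 / v x)" if "s \<in> {T..t}" for s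
    using that T weight_tail_split[OF v _ _ L, of s t]
      set_lebesgue_integral_eq_integral(2)[OF admissible_weight_integrable[OF v, of s t]]
    by (simp add: H_def)
  have "continuous_on {T..t} (\<lambda>s. H t + integral {s..t} (\<lambda>x. 1 / v x))"
    by (rule continuous_on_add[OF continuous_on_const indefinite_integral_continuous_1'[OF
            set_lebesgue_integral_eq_integral(1)[OF admissible_weight_integrable[OF v T]]]])
  then have "continuous_on {T..t} H"
    by (rule continuous_on_eq) (rule H_eq[symmetric])
  then have "continuous_on {T..t} (\<lambda>s. 1 / (2 * H s))"
    by (intro continuous_intros ballI) (use H_pos in force)+
  then have "Linf_loc {T..t} (\<lambda>s. 1 / (2 * H s))"
    by (rule Linf_loc_continuous) simp
  moreover have "Linf_loc {T..t} (\<lambda>s. 1 / v s)"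
    by (rule Linf_loc_subset[of "{0<..}"]) (use v T in \<open>auto simp: admissible_weight_def\<close>)
  ultimately have "Linf_loc {T..t} (\<lambda>s. sqrt (critical_fun v s))"
    unfolding sqrt_critical_fun H_def by (intro Linf_loc_abs Linf_loc_mult)
  then show ?thesis by (rule Linf_loc_set_integrable) auto
qed

text \<open>With \<open>H\<close> the tail integral, \<open>H' = - 1 / v\<close> and
  \<open>sqrt \<chi> = 1 / (2 v H)\<close> almost everywhere, so \<open>2 * sqrt \<chi>\<close> is
  the derivative of \<open>- ln H\<close>. The inequality trades the critical function in the
  oscillation condition for the tail beyond \<open>t\<close>.\<close>

lemma sqrt_critical_fun_integral_ge:
  assumes v: "admissible_weight v" and T: "0 < T" "T \<le> t" and L: "L1_at_infinity (\<lambda>s. 1 / v s)"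
  shows "ln (LINT s:{T..}|lebesgue. 1 / v s) - ln (LINT s:{t..}|lebesgue. 1 / v s)
    \<le> 2 * (LINT s:{T..t}|lebesgue. sqrt (critical_fun v s))"
proof -
  define H where "H s = (LINT x:{s..}|lebesgue. 1 / v x)" for s
  define \<psi> where "\<psi> s = sqrt (critical_fun v s)" for s
  define \<phi> where "\<phi> s = 2 * (LINT x:{T..s}|lebesgue. \<psi> x) + ln (H s)" for s
  have H_pos: "0 < H s" if "T \<le> s" for s
    unfolding H_def using that T by (intro weight_tail_pos v L) auto
  have H_split: "H s = (LINT x:{s..s'}|lebesgue. 1 / v x) + H s'" if "T \<le> s" "s \<le> s'" for s s'
    unfolding H_def using that T by (intro weight_tail_split v L) auto
  have w_nonneg: "AE x in lebesgue. x \<in> {s..s'} \<longrightarrow> 0 \<le> 1 / v x" if "T \<le> s" for s s'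
    using admissible_weight_pos[OF v] by eventually_elim (use that T in auto)
  have H_antimono: "H s' \<le> H s" if "T \<le> s" "s \<le> s'" for s s'
    using H_split[of s s'] that set_integral_nonneg_AE[OF w_nonneg[of s s']] by simp
  have \<psi>_int: "set_integrable lebesgue {s..s'} \<psi>" if "T \<le> s" for s s'
    unfolding \<psi>_def using that T by (intro sqrt_critical_fun_integrable v L) auto
  have "compact {T..t}" "{T..t} \<subseteq> {0<..}" using T by auto
  then obtain C where C: "AE x in lebesgue. x \<in> {T..t} \<longrightarrow> \<bar>1 / v x\<bar> \<le> C"
    using v unfolding admissible_weight_def Linf_loc_def by blast
  have "\<phi> T \<le> \<phi> t"
  \<comment> \<open>Over one step, twice the integral of \<open>\<psi>\<close> is at least
    \<open>d / H s\<close>, while \<open>ln H\<close> drops by at most \<open>d / H s'\<close>. The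
    gap \<open>d\<^sup>2 / (H s' * H s)\<close> is bounded using \<open>d \<le> C * (s' - s)\<close>
    and the fact that \<open>H\<close> is at least \<open>H t\<close> on
    \<open>[T, t]\<close>.\<close>
  proof (rule quadratic_error_mono[where \<phi> = \<phi> and K = "C\<^sup>2 / (H t)\<^sup>2"])
    fix s s' assume s: "T \<le> s" "s \<le> s'" "s' \<le> t"
    define d where "d = (LINT x:{s..s'}|lebesgue. 1 / v x)"
    have d: "0 \<le> d" unfolding d_def using s by (intro set_integral_nonneg_AE w_nonneg)
    have pos: "0 < H s" "0 < H s'" "0 < H t" "H t \<le> H s'" "H t \<le> H s"
      using H_pos H_antimono s by auto
    have "d \<le> (LINT x:{s..s'}|lebesgue. C)"
      unfolding d_def
    proof (rule set_integral_mono_AE)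
      show "AE x\<in>{s..s'} in lebesgue. 1 / v x \<le> C"
        using C
      proof eventually_elim
        case (elim x)
        then show ?case using s abs_ge_self[of "1 / v x"] by auto
      qed
    qed (use s T in \<open>auto intro!: admissible_weight_integrable v\<close>)
    also have "\<dots> = C * (s' - s)"
      using s by (simp add: set_integral_const)
    finally have d_le: "d\<^sup>2 \<le> C\<^sup>2 * (s' - s)\<^sup>2" using d by (simp add: power_mono flip: power_mult_distrib)
    \<comment> \<open>The tail decreases, so freezing it at the left endpoint bounds
      \<open>\<psi>\<close> from below.\<close>
    have "(LINT x:{s..s'}|lebesgue. 1 / (2 * H s) * (1 / v x)) \<le> (LINT x:{s..s'}|lebesgue. \<psi> x)"
    proof (rule set_integral_mono_AE)
      show "AE x\<in>{s..s'} in lebesgue. 1 / (2 * H s) * (1 / v x) \<le> \<psi> x"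
        using w_nonneg[OF s(1), of s']
      proof eventually_elim
        case x: (elim x)
        show ?case
        proof
          assume xs: "x \<in> {s..s'}"
          have "0 < H x" "H x \<le> H s" using xs s H_pos H_antimono by auto
          then have "1 / (2 * H s) * (1 / v x) \<le> 1 / (2 * H x) * (1 / v x)"
            using x xs pos by (intro mult_right_mono) (auto simp: field_simps)
          also have "\<dots> \<le> \<psi> x"
            unfolding \<psi>_def sqrt_critical_fun H_def by (subst mult.commute) (rule abs_ge_self)
          finally show "1 / (2 * H s) * (1 / v x) \<le> \<psi> x" .
        qed
      qed
      show "set_integrable lebesgue {s..s'} (\<lambda>x. 1 / (2 * H s) * (1 / v x))"
        using s T by (intro set_integrable_mult_right admissible_weight_integrable v) auto
      show "set_integrable lebesgue {s..s'} \<psi>" using s by (intro \<psi>_int)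
    qed
    then have "d / H s \<le> 2 * (LINT x:{s..s'}|lebesgue. \<psi> x)"
      by (simp only: set_integral_mult_right flip: d_def) (simp add: field_simps)
    moreover have "ln (H s) - ln (H s') \<le> d / H s'"
    proof -
      have "ln (H s) - ln (H s') = ln (H s / H s')" using pos by (simp add: ln_div)
      also have "\<dots> \<le> H s / H s' - 1" using pos by (intro ln_le_minus_one) simp
      also have "\<dots> = d / H s'" using H_split[of s s'] s pos by (simp add: d_def field_simps)
      finally show ?thesis .
    qed
    moreover have "d / H s' - d / H s \<le> C\<^sup>2 / (H t)\<^sup>2 * (s' - s)\<^sup>2"
    proof -
      have "d / H s' - d / H s = d\<^sup>2 / (H s' * H s)"
        using H_split[of s s'] s pos by (simp add: d_def field_simps power2_eq_square)
      also have "\<dots> \<le> (C\<^sup>2 * (s' - s)\<^sup>2) / (H t)\<^sup>2"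
        unfolding power2_eq_square[of "H t"] using pos d_le by (intro frac_le mult_mono) auto
      finally show ?thesis by simp
    qed
    moreover have "(LINT x:{T..s'}|lebesgue. \<psi> x) = (LINT x:{T..s}|lebesgue. \<psi> x) + (LINT x:{s..s'}|lebesgue. \<psi> x)"
      using s by (intro set_integral_combine \<psi>_int) auto
    ultimately show "\<phi> s - C\<^sup>2 / (H t)\<^sup>2 * (s' - s)\<^sup>2 \<le> \<phi> s'"
      unfolding \<phi>_def by linarith
  qed (use T in simp)
  moreover have "(LINT x:{T..T}|lebesgue. \<psi> x) = 0"
    using set_lebesgue_integral_eq_integral(2)[OF \<psi>_int[of T T]] by simp
  ultimately show ?thesis
    unfolding \<phi>_def H_def \<psi>_def by simp
qed

section \<open>Unique solvability for the bound, and first zeros\<close>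

text \<open>The integral is continuous in \<open>R\<close>, equals 0 at \<open>t\<close> and exceeds
  \<open>c\<close> at \<open>R'\<close>, so the level is attained; positivity of the integral of
  \<open>1 / v\<close> over nondegenerate intervals makes it strictly increasing, hence
  uniqueness.\<close>

lemma weight_integral_attains:
  assumes v: "admissible_weight v" and t: "0 < t" and c: "0 < c"
    and R: "t < R'" "c < (LINT s:{t..R'}|lebesgue. 1 / v s)"
  shows "\<exists>!R. t < R \<and> (LINT s:{t..R}|lebesgue. 1 / v s) = c"
proof -
  define F where "F R = (LINT s:{t..R}|lebesgue. 1 / v s)" for R
  have F_eq: "F R = integral {t..R} (\<lambda>s. 1 / v s)" for R
    unfolding F_def by (intro set_lebesgue_integral_eq_integral admissible_weight_integrable v t)
  have F_strict: "F r < F R" if "t \<le> r" "r < R" for r R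
    using set_integral_combine[OF admissible_weight_integrable[OF v t, of R], of r] that t
      admissible_weight_integral_pos[OF v, of r R]
    by (simp add: F_def)
  have "continuous_on {t..R'} F"
    unfolding F_eq by (intro indefinite_integral_continuous_1 set_lebesgue_integral_eq_integral(1)
        admissible_weight_integrable v t)
  then obtain R where R: "t \<le> R" "F R = c"
    using IVT'[of F t c R'] c assms(4,5) F_eq[of t] by (auto simp: F_def)
  moreover have "R \<noteq> t" using R c F_eq[of t] by auto
  ultimately have "t < R \<and> F R = c" by simp
  moreover have "r = r'" if "t < r \<and> F r = c" "t < r' \<and> F r' = c" for r r'
    using F_strict[of r r'] F_strict[of r' r] that by (cases r r' rule: linorder_cases) auto
  ultimately show ?thesis unfolding F_def by blast
qed

text \<open>The zeros in \<open>[0, x]\<close> form a nonempty closed set, which contains its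
  infimum; \<open>z 0 \<noteq> 0\<close> keeps that infimum away from 0.\<close>

lemma first_zero:
  fixes z :: "real \<Rightarrow> real"
  assumes "continuous_on {0..} z" "z 0 \<noteq> 0" "0 \<le> x" "z x = 0"
  obtains y where "0 < y" "y \<le> x" "z y = 0" "\<And>s. 0 \<le> s \<Longrightarrow> s < y \<Longrightarrow> z s \<noteq> 0"
proof -
  define Z where "Z = {s \<in> {0..x}. z s = 0}"
  have "continuous_on {0..x} z"
    using assms(1) by (rule continuous_on_subset) auto
  then have "closed Z"
    unfolding Z_def by (intro continuous_closed_preimage_constant) auto
  moreover have ne: "Z \<noteq> {}" and bdd: "bdd_below Z"
    using assms by (auto simp: Z_def)
  ultimately have "Inf Z \<in> Z" by (intro closed_contains_Inf)
  then have y: "0 \<le> Inf Z" "Inf Z \<le> x" "z (Inf Z) = 0" by (auto simp: Z_def)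
  moreover have "Inf Z \<noteq> 0" using y assms(2) by auto
  moreover have "z s \<noteq> 0" if "0 \<le> s" "s < Inf Z" for s
  proof
    assume "z s = 0"
    then have "s \<in> Z" using that y by (auto simp: Z_def)
    then show False using cInf_lower[OF _ bdd] that by force
  qed
  ultimately show ?thesis using that[of "Inf Z"] by simp
qed

section \<open>Existence and localisation of the first zero\<close>

theorem corollary2p3:
  fixes A v :: "real \<Rightarrow> real" and T t :: real
  assumes "admissible_potential A"
    and "admissible_weight v"
    and "0 < T" and "T < t"
    and "(\<not> L1_at_infinity (\<lambda>s. 1 / v s) \<and>
            \<not> (AE s in lebesgue. s \<in> {0..T} \<longrightarrow> A s = 0)) \<or>
         (L1_at_infinity (\<lambda>s. 1 / v s) \<and> oscillation_condition A v T t)"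
  shows "(\<forall>z z0. 0 < z0 \<and> cauchy_solution A v z0 z \<longrightarrow> (\<exists>T0>0. z T0 = 0)) \<and>
         (\<exists>!R. zero_bound A v T t R) \<and>
         (\<forall>R. zero_bound A v T t R \<longrightarrow>
            (\<forall>z z0. 0 < z0 \<and> cauchy_solution A v z0 z \<longrightarrow>
               (\<exists>T0. 0 < T0 \<and> T0 \<le> R \<and> z T0 = 0 \<and> (\<forall>s. 0 \<le> s \<and> s < T0 \<longrightarrow> z s \<noteq> 0))))"
proof -
  note A = assms(1) and v = assms(2)
  have t: "0 < t" using assms(3,4) by simp
  define I where "I = (LINT s:{0..T}|lebesgue. A s * v s)"
  define Q where "Q = (LINT s:{T..t}|lebesgue. sqrt (A s))"
  \<comment> \<open>The level that the integral of \<open>1 / v\<close> over \<open>[t, R]\<close>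
    has to reach, according to \<open>zero_bound_iff\<close>.\<close>
  define c where "c = exp (- 2 * Q) / I"
  have A_Linf: "Linf_loc {0..} A" and A_nonneg: "AE s in lebesgue. 0 \<le> s \<longrightarrow> 0 \<le> A s"
    using A by (auto simp: admissible_potential_def)
  have v_Linf: "Linf_loc {0..} v" and v_nonneg: "AE s in lebesgue. 0 \<le> s \<longrightarrow> 0 \<le> v s"
    and v_nonzero: "AE s in lebesgue. 0 < s \<longrightarrow> v s \<noteq> 0"
    using v by (auto simp: admissible_weight_def)
  have I_pos: "0 < I"
    using assms(5)
  proof
    assume "\<not> L1_at_infinity (\<lambda>s. 1 / v s) \<and> \<not> (AE s in lebesgue. s \<in> {0..T} \<longrightarrow> A s = 0)"
    then have A_ne: "\<not> (AE s in lebesgue. s \<in> {0..T} \<longrightarrow> A s = 0)" by simp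
    show ?thesis
      unfolding I_def
    proof (rule set_integral_pos_AE)
      show "set_integrable lebesgue {0..T} (\<lambda>s. A s * v s)"
        by (rule Linf_loc_set_integrable[OF Linf_loc_mult[OF A_Linf v_Linf]]) auto
      show "AE s in lebesgue. s \<in> {0..T} \<longrightarrow> 0 \<le> A s * v s"
        using A_nonneg v_nonneg by eventually_elim auto
      show "\<not> (AE s in lebesgue. s \<in> {0..T} \<longrightarrow> A s * v s = 0)"
      proof
        assume "AE s in lebesgue. s \<in> {0..T} \<longrightarrow> A s * v s = 0"
        \<comment> \<open>\<open>v_nonzero\<close> concerns \<open>s > 0\<close>, so the endpoint 0
          of \<open>[0, T]\<close> is discarded as a null set.\<close>
        moreover have "AE s in lebesgue. s \<noteq> (0::real)"
          by (rule AE_completion[OF AE_lborel_singleton])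
        ultimately have "AE s in lebesgue. s \<in> {0..T} \<longrightarrow> A s = 0"
          using v_nonzero by eventually_elim auto
        then show False using A_ne by blast
      qed
    qed
  next
    assume "L1_at_infinity (\<lambda>s. 1 / v s) \<and> oscillation_condition A v T t"
    then show ?thesis by (simp add: oscillation_condition_def I_def)
  qed
  have c_pos: "0 < c" using I_pos by (simp add: c_def)
  have "\<exists>R>t. c < (LINT s:{t..R}|lebesgue. 1 / v s)"
    using assms(5)
  proof
    assume "\<not> L1_at_infinity (\<lambda>s. 1 / v s) \<and> \<not> (AE s in lebesgue. s \<in> {0..T} \<longrightarrow> A s = 0)"
    then show ?thesis by (intro weight_integral_unbounded v t) simp
  next
    assume asm: "L1_at_infinity (\<lambda>s. 1 / v s) \<and> oscillation_condition A v T t"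
    then have L: "L1_at_infinity (\<lambda>s. 1 / v s)" by simp
    define H where "H = (LINT s:{t..}|lebesgue. 1 / v s)"
    have H_pos: "0 < H" unfolding H_def by (rule weight_tail_pos[OF v t L])
    have "(LINT s:{T..t}|lebesgue. sqrt (A s) - sqrt (critical_fun v s))
      = Q - (LINT s:{T..t}|lebesgue. sqrt (critical_fun v s))"
      unfolding Q_def using assms(3)
      by (intro set_integral_diff sqrt_critical_fun_integrable v L
          Linf_loc_set_integrable[OF Linf_loc_sqrt[OF A_Linf]]) auto
    moreover have "(LINT s:{T..t}|lebesgue. sqrt (A s) - sqrt (critical_fun v s)) >
       - (1 / 2) * (ln I + ln (LINT s:{T..}|lebesgue. 1 / v s))"
      using asm unfolding oscillation_condition_def I_def by blast
    \<comment> \<open>Bounding the integral of \<open>sqrt \<chi>\<close> from below cancels the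
      logarithm of the tail at \<open>T\<close> and leaves the one at \<open>t\<close>. The result
      is \<open>ln c < ln H\<close>: the whole tail exceeds the level, and so do its truncations for
      large \<open>R\<close>.\<close>
    ultimately have "- 2 * Q - ln I < ln H"
      using sqrt_critical_fun_integral_ge[OF v assms(3) less_imp_le[OF assms(4)] L]
      unfolding H_def by argo
    moreover have "- 2 * Q - ln I = ln c"
      using I_pos by (simp add: c_def ln_div)
    ultimately have "c < H" using c_pos H_pos by simp
    moreover have "((\<lambda>R. LINT s:{t..R}|lebesgue. 1 / v s) \<longlongrightarrow> H) at_top"
      unfolding H_def by (intro tendsto_set_lebesgue_integral_at_top weight_tail_integrable v t L) simp
    ultimately have "\<forall>\<^sub>F R in at_top. c < (LINT s:{t..R}|lebesgue. 1 / v s)"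
      by (rule order_tendstoD(1)[rotated])
    then have "\<forall>\<^sub>F R in at_top. t < R \<and> c < (LINT s:{t..R}|lebesgue. 1 / v s)"
      using eventually_gt_at_top by (rule eventually_conj[rotated])
    then show ?thesis by (auto dest: eventually_happens)
  qed
  then have ex1: "\<exists>!R. zero_bound A v T t R"
    unfolding zero_bound_iff[OF v t I_pos[unfolded I_def]]
    using weight_integral_attains[OF v t c_pos] unfolding c_def Q_def I_def by blast
  have zero: "\<exists>T0. 0 < T0 \<and> T0 \<le> R \<and> z T0 = 0 \<and> (\<forall>s. 0 \<le> s \<and> s < T0 \<longrightarrow> z s \<noteq> 0)"
    if R: "zero_bound A v T t R" and z: "0 < z0" "cauchy_solution A v z0 z" for R z z0
  proof -
    have z_cont: "continuous_on {0..} z"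
      using z(2) by (rule continuous_on_cauchy_solution)
    have "z 0 = z0" using z(2) by (rule cauchy_solution_init)
    \<comment> \<open>Without a zero in \<open>[0, R]\<close>, the strict inequality would
      contradict the equality in \<open>zero_bound\<close>.\<close>
    obtain x where x: "0 \<le> x" "x \<le> R" "z x = 0"
      using cauchy_solution_positive_bound[OF A v assms(3,4) _ I_pos[unfolded I_def] z(2,1), of R] R
      unfolding zero_bound_def by force
    show ?thesis
      using first_zero[OF z_cont _ x(1,3)] \<open>z 0 = z0\<close> z(1) x(2)
      by (metis less_irrefl order_trans)
  qed
  \<comment> \<open>The first conjunct follows by applying \<open>zero\<close> to the bound supplied
    by \<open>ex1\<close>.\<close>
  then show ?thesis using ex1 by blast
qed

end
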